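(* Let $r\ge1$ and let $a_1,\dots,a_r$ be nonzero complex numbers. For integers $n,m$ with $n-1\ge m\ge1$, \begin{align*} &\sum_{l=0}^{n-m}\binom{n}{l}S_1(n-l,m)D_l(a_1,\dots,a_r) =\sum_{l=0}^{n-m}\binom{n-1}{l}S_1(n-l-1,m-1)D_l(-1|a_1,\dots,a_r)\\ &\quad+\frac1n\sum_{l=0}^{n-m-1}\binom{n}{l+1}S_1(n-l-1,m)\left(r\sum_{i=0}^{l+1}\binom{l+1}{i}c_iD_{l+1-i}(-1|a_1,\dots,a_r)-\sum_{j=1}^r\sum_{i=0}^{l+1}\binom{l+1}{i}a_jc_iD_{l+1-i}(a_j-1|a_1,\dots,a_r,a_j)\right), \end{align*} and \begin{align*} &\sum_{l=0}^{n-m}\binom{n}{l}S_1(n-l,m)\widehat D_l(a_1,\dots,a_r) =\sum_{l=0}^{n-m}\binom{n-1}{l}S_1(n-l-1,m-1)\widehat D_l(-1|a_1,\dots,a_r)\\ &\quad+\frac1n\sum_{l=0}^{n-m-1}\binom{n}{l+1}S_1(n-l-1,m)\left(r\sum_{i=0}^{l+1}\binom{l+1}{i}c_i\widehat D_{l+1-i}(-1|a_1,\dots,a_r)-\sum_{j=1}^r\sum_{i=0}^{l+1}\binom{l+1}{i}a_jc_i\widehat D_{l+1-i}(-1|a_1,\dots,a_r,a_j)\right)\\ &\quad+\sum_{l=0}^{n-m-1}\binom{n-1}{l}S_1(n-l-1,m)\sum_{j=1}^ra_j\widehat D_l(-1|a_1,\dots,a_r). \end{align*}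
   Context: For any $k\ge1$ and nonzero complex $b_1,\dots,b_k$, the Barnes-type Daehee polynomials of the first and second kind are defined by the formal power series identities $\prod_{j=1}^k\frac{\ln(1+t)}{(1+t)^{b_j}-1}(1+t)^x=\sum_{n\ge0}D_n(x|b_1,\dots,b_k)\frac{t^n}{n!}$ and $\prod_{j=1}^k\frac{(1+t)^{b_j}\ln(1+t)}{(1+t)^{b_j}-1}(1+t)^x=\sum_{n\ge0}\widehat D_n(x|b_1,\dots,b_k)\frac{t^n}{n!}$; the numbers are $D_n(b_1,\dots,b_k)=D_n(0|b_1,\dots,b_k)$, $\widehat D_n(b_1,\dots,b_k)=\widehat D_n(0|b_1,\dots,b_k)$. In the claim, $(a_1,\dots,a_r,a_j)$ denotes the list of $r+1$ parameters obtained by appending $a_j$ once more. $S_1(n,m)$ are the signed Stirling numbers of the first kind: $x(x-1)\cdots(x-n+1)=\sum_{m=0}^nS_1(n,m)x^m$. The Cauchy numbers $c_n$ are defined by $\frac{t}{\ln(1+t)}=\sum_{n\ge0}c_n\frac{t^n}{n!}$. *)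

theory Defs
  imports Complex_Main "HOL-Computational_Algebra.Computational_Algebra"
begin

text \<open>
  Here \<open>fps_binomial x\<close> is the binomial series of \<open>(1 + t)\<close> to the complex power \<open>x\<close>, and
  \<open>fps_ln 1\<close> is the series of \<open>ln (1 + t)\<close>.
\<close>

text \<open>
  Barnes-type Daehee polynomials of the first and second kind, evaluated at \<open>x\<close>;
  \<open>bs\<close> is the list of parameters. For \<open>b \<noteq> 0\<close> numerator and denominator of each factor have
  subdegree 1, so that the quotient is the genuine one (see \<open>daehee_quotient\<close>).
\<close>

definition daehee_poly :: "nat \<Rightarrow> complex \<Rightarrow> complex list \<Rightarrow> complex" where
  "daehee_poly n x bs =
     fact n * fps_nth ((\<Prod>b\<leftarrow>bs. fps_ln 1 / (fps_binomial b - 1)) * fps_binomial x) n"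

definition daehee_poly2 :: "nat \<Rightarrow> complex \<Rightarrow> complex list \<Rightarrow> complex" where
  "daehee_poly2 n x bs =
     fact n * fps_nth ((\<Prod>b\<leftarrow>bs. fps_binomial b * fps_ln 1 / (fps_binomial b - 1)) * fps_binomial x) n"

definition daehee_num :: "nat \<Rightarrow> complex list \<Rightarrow> complex" where
  "daehee_num n bs = daehee_poly n 0 bs"

definition daehee_num2 :: "nat \<Rightarrow> complex list \<Rightarrow> complex" where
  "daehee_num2 n bs = daehee_poly2 n 0 bs"

definition S1 :: "nat \<Rightarrow> nat \<Rightarrow> int" where
  "S1 n m = poly.coeff (\<Prod>k<n. [:- int k, 1:]) m"

definition cauchy_num :: "nat \<Rightarrow> complex" where
  "cauchy_num n = fact n * fps_nth (fps_X / fps_ln 1) n"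

lemma daehee_egf:
  "Abs_fps (\<lambda>n. daehee_poly n x bs / fact n) =
     (\<Prod>b\<leftarrow>bs. fps_ln 1 / (fps_binomial b - 1)) * fps_binomial x"
  "Abs_fps (\<lambda>n. daehee_poly2 n x bs / fact n) =
     (\<Prod>b\<leftarrow>bs. fps_binomial b * fps_ln 1 / (fps_binomial b - 1)) * fps_binomial x"
  by (simp_all add: fps_eq_iff daehee_poly_def daehee_poly2_def)

lemma subdegree_fps_ln1: "subdegree (fps_ln 1 :: complex fps) = 1"
  by (rule subdegreeI) (simp_all add: fps_ln_def)

lemma subdegree_binomial_minus_1:
  "b \<noteq> 0 \<Longrightarrow> subdegree (fps_binomial b - 1 :: complex fps) = 1"
  by (rule subdegreeI) (simp_all add: fps_binomial_def)

lemma daehee_quotient: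
  assumes "(b :: complex) \<noteq> 0"
  shows "fps_ln 1 / (fps_binomial b - 1) * (fps_binomial b - 1) = (fps_ln 1 :: complex fps)"
    and "fps_binomial b * fps_ln 1 / (fps_binomial b - 1) * (fps_binomial b - 1) =
           fps_binomial b * (fps_ln 1 :: complex fps)"
proof -
  have nz: "fps_binomial b - 1 \<noteq> 0" "(fps_ln 1 :: complex fps) \<noteq> 0"
    using subdegree_binomial_minus_1[OF assms] subdegree_fps_ln1 by force+
  have dvd: "(fps_binomial b - 1) dvd (fps_ln 1 :: complex fps)"
    using fps_dvd_iff[OF nz] subdegree_fps_ln1 subdegree_binomial_minus_1[OF assms] by presburger
  then show "fps_ln 1 / (fps_binomial b - 1) * (fps_binomial b - 1) = (fps_ln 1 :: complex fps)"
    by simp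
  from dvd show "fps_binomial b * fps_ln 1 / (fps_binomial b - 1) * (fps_binomial b - 1) =
           fps_binomial b * (fps_ln 1 :: complex fps)"
    by (metis dvd_div_mult_self dvd_mult)
qed

lemma cauchy_egf: "Abs_fps (\<lambda>n. cauchy_num n / fact n) * fps_ln 1 = fps_X"
proof -
  have "(fps_ln 1 :: complex fps) dvd fps_X"
    using subdegree_fps_ln1 by (subst fps_dvd_iff) auto
  moreover have "Abs_fps (\<lambda>n. cauchy_num n / fact n) = fps_X / fps_ln 1"
    by (simp add: fps_eq_iff cauchy_num_def)
  ultimately show ?thesis by simp
qed

lemma S1_falling_factorial:
  "(\<Prod>k<n. x - int k) = (\<Sum>m\<le>n. S1 n m * x ^ m)"
proof -
  let ?p = "\<Prod>k<n. [:- int k, 1:]"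
  have "(\<Prod>k<n. x - int k) = poly ?p x"
    by (simp add: poly_prod)
  also have "degree ?p = n"
    by (subst degree_prod_eq_sum_degree) auto
  then have "poly ?p x = (\<Sum>m\<le>n. S1 n m * x ^ m)"
    by (simp add: poly_altdef S1_def)
  finally show ?thesis .
qed

end

theory Submission
  imports Defs
begin

text \<open>
  Write \<open>F\<close> for the generating series of the numbers in question. As \<open>ln (1 + t) ^ m / m!\<close> is the
  exponential generating series of \<open>S1 _ m\<close>, the left-hand side is \<open>n!\<close> times the \<open>n\<close>-th coefficient of
  \<open>G = ln (1 + t) ^ m / m! * F\<close>, that is, \<open>(n - 1)!\<close> times the coefficient of index \<open>n - 1\<close> of \<open>G'\<close>.
  By the product rule \<open>G'\<close> has two parts; the part containing \<open>F'\<close> is evaluated by logarithmic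
  differentiation of \<open>F\<close>, the factor \<open>1 / ln (1 + t)\<close> being expressed through the Cauchy series
  \<open>t / ln (1 + t)\<close>.
\<close>

section \<open>Stirling numbers and powers of the logarithm\<close>

lemma fact_mult_fps_mult_nth:
  fixes A B :: "'a :: field_char_0 fps"
  shows "fact n * fps_nth (A * B) n =
    (\<Sum>i=0..n. of_nat (n choose i) * (fact i * fps_nth A i) * (fact (n - i) * fps_nth B (n - i)))"
  by (simp add: fps_mult_nth sum_distrib_left binomial_fact mult_ac)

lemma S1_0_right: "S1 n 0 = (if n = 0 then 1 else 0)"
  by (auto simp: S1_def coeff_0_power poly_0_coeff_0[symmetric] poly_prod)

lemma S1_eq_0: "n < m \<Longrightarrow> S1 n m = 0"
  unfolding S1_def by (rule coeff_eq_0) (subst degree_prod_eq_sum_degree; auto)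

lemma S1_Suc_Suc: "S1 (Suc n) (Suc m) = S1 n m - int n * S1 n (Suc m)"
  by (simp add: S1_def)

text \<open>The series 1/(1+t) is kept in the form \<open>fps_binomial (-1)\<close>, so that
  multiplying by it visibly lowers the argument of a Daehee polynomial by 1.\<close>

lemma inverse_one_plus_X: "inverse (1 + fps_X) = (fps_binomial (-1) :: complex fps)"
  by (simp add: fps_binomial_minus_one)

lemma one_plus_X_mult_fps_binomial: "(1 + fps_X) * fps_binomial (-1) = (1 :: complex fps)"
  unfolding inverse_one_plus_X[symmetric] by (rule inverse_mult_eq_1') simp

lemma fps_deriv_ln_one: "fps_deriv (fps_ln 1) = (fps_binomial (-1) :: complex fps)"
  by (simp add: fps_ln_deriv fps_binomial_minus_one)

lemma fps_deriv_binomial: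
  "fps_deriv (fps_binomial b) = fps_const b * fps_binomial b * (fps_binomial (-1) :: complex fps)"
  by (simp add: fps_binomial_deriv fps_divide_unit fps_binomial_minus_one)

lemma fps_binomial_diff_1:
  "fps_binomial (b - 1) = fps_binomial b * (fps_binomial (-1) :: complex fps)"
  using fps_binomial_add_mult[of b "-1"] by simp

definition ln_pow :: "nat \<Rightarrow> complex fps" where
  "ln_pow m = fps_const (1 / fact m) * fps_ln 1 ^ m"

lemma fps_deriv_ln_pow: "fps_deriv (ln_pow (Suc m)) = ln_pow m * fps_binomial (-1)"
proof -
  have "fps_const (1 / fact (Suc m)) * of_nat (Suc m) = (fps_const (1 / fact m) :: complex fps)"
    by (simp add: fps_of_nat[symmetric] divide_simps del: of_nat_Suc)
  moreover have "fps_deriv (ln_pow (Suc m)) =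
      (fps_const (1 / fact (Suc m)) * of_nat (Suc m)) * (fps_ln 1 ^ m * fps_binomial (-1))"
    unfolding ln_pow_def
    by (simp add: fps_deriv_power fps_deriv_ln_one fps_of_nat mult.assoc mult.left_commute
        del: of_nat_Suc power_Suc fact_Suc)
  ultimately show ?thesis
    by (simp only: ln_pow_def mult.assoc)
qed

text \<open>Both sides obey the same recurrence: with L = \<open>ln_pow (Suc m)\<close>, the
  coefficients of (1+t) L' = \<open>ln_pow m\<close> give \<open>S1_Suc_Suc\<close> after
  multiplication by k!.\<close>

lemma S1_eq_fact_mult_ln_pow_nth: "of_int (S1 n m) = fact n * fps_nth (ln_pow m) n"
proof (induction m arbitrary: n)
  case 0
  show ?case by (simp add: ln_pow_def S1_0_right)
next
  case (Suc m)
  let ?L = "ln_pow (Suc m)"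
  have "(1 + fps_X) * fps_deriv ?L = ln_pow m * ((1 + fps_X) * fps_binomial (-1))"
    by (simp add: fps_deriv_ln_pow mult_ac)
  then have deriv: "(1 + fps_X) * fps_deriv ?L = ln_pow m"
    by (simp add: one_plus_X_mult_fps_binomial)
  show ?case
  proof (induction n)
    case 0
    show ?case by (simp add: ln_pow_def S1_eq_0 fps_ln_def)
  next
    case (Suc k)
    have "fps_nth ((1 + fps_X) * fps_deriv ?L) k = of_nat (Suc k) * fps_nth ?L (Suc k) + of_nat k * fps_nth ?L k"
      by (cases k) (simp_all add: distrib_right)
    then have "fps_nth (ln_pow m) k = of_nat (Suc k) * fps_nth ?L (Suc k) + of_nat k * fps_nth ?L k"
      by (simp only: deriv)
    then show ?case
      \<comment> \<open>Here \<open>Suc.IH\<close> belongs to the inner induction; the quoted fact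
        is the hypothesis of the outer one, on \<open>m\<close>.\<close>
      using Suc.IH \<open>\<And>n. of_int (S1 n m) = fact n * fps_nth (ln_pow m) n\<close>[of k]
      by (simp add: S1_Suc_Suc algebra_simps)
  qed
qed

text \<open>The binomial convolution stops at \<open>n-m\<close> because \<open>S1 (n-l) m\<close>
  vanishes as soon as \<open>n-l < m\<close>.\<close>

lemma fact_mult_ln_pow_mult_nth:
  fixes F :: "complex fps"
  assumes "m \<le> n"
  shows "fact n * fps_nth (ln_pow m * F) n =
    (\<Sum>l=0..n-m. of_nat (n choose l) * of_int (S1 (n-l) m) * (fact l * fps_nth F l))"
proof -
  have "fact n * fps_nth (ln_pow m * F) n =
      (\<Sum>l=0..n. of_nat (n choose l) * of_int (S1 (n-l) m) * (fact l * fps_nth F l))"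
    by (subst mult.commute[of "ln_pow m"], subst fact_mult_fps_mult_nth)
       (simp add: S1_eq_fact_mult_ln_pow_nth mult_ac)
  also have "\<dots> = (\<Sum>l=0..n-m. of_nat (n choose l) * of_int (S1 (n-l) m) * (fact l * fps_nth F l))"
    by (rule sum.mono_neutral_right) (use assms in \<open>auto simp: S1_eq_0\<close>)
  finally show ?thesis .
qed

text \<open>The upper limits differ because the convolution is taken at index \<open>n-1\<close> in
  both parts, but with \<open>ln_pow (m-1)\<close> in the first and \<open>ln_pow m\<close> in the
  second.\<close>

lemma S1_convolution_deriv:
  fixes F :: "complex fps"
  assumes "m \<ge> 1" and "n - 1 \<ge> m"
  shows "(\<Sum>l=0..n-m. of_nat (n choose l) * of_int (S1 (n-l) m) * (fact l * fps_nth F l)) =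
    (\<Sum>l=0..n-m. of_nat ((n-1) choose l) * of_int (S1 (n-l-1) (m-1)) *
       (fact l * fps_nth (F * fps_binomial (-1)) l)) +
    (\<Sum>l=0..n-m-1. of_nat ((n-1) choose l) * of_int (S1 (n-l-1) m) * (fact l * fps_nth (fps_deriv F) l))"
proof -
  obtain k where m: "m = Suc k" using assms by (cases m) auto
  obtain p where n: "n = Suc p" using assms by (cases n) auto
  have le: "m \<le> p" "k \<le> p" "m \<le> n" using assms m n by auto
  have "fact n * fps_nth (ln_pow m * F) n = fact p * fps_nth (fps_deriv (ln_pow m * F)) p"
    by (simp only: n fps_deriv_nth fact_Suc mult_ac Suc_eq_plus1[symmetric])
  also have "fps_deriv (ln_pow m * F) = ln_pow k * (F * fps_binomial (-1)) + ln_pow m * fps_deriv F"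
    by (simp add: m fps_deriv_ln_pow mult_ac)
  finally have "fact n * fps_nth (ln_pow m * F) n =
      fact p * fps_nth (ln_pow k * (F * fps_binomial (-1))) p + fact p * fps_nth (ln_pow m * fps_deriv F) p"
    by (simp add: distrib_left)
  then show ?thesis
    unfolding fact_mult_ln_pow_mult_nth[OF le(1)] fact_mult_ln_pow_mult_nth[OF le(2)]
      fact_mult_ln_pow_mult_nth[OF le(3)]
    by (simp add: m n diff_right_commute)
qed

text \<open>This rests on (l+1) C(n,l+1) = n C(n-1,l). It accounts for the factor 1/n and the shift
  to l+1: logarithmic differentiation yields a formula for t F' rather than F'.\<close>

lemma choose_mult_fact_mult_X_mult_nth:
  fixes G :: "'a :: field_char_0 fps"
  assumes "n > 0"
  shows "1 / of_nat n * (of_nat (n choose (l+1)) * (fact (l+1) * fps_nth (fps_X * G) (l+1))) =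
    of_nat ((n-1) choose l) * (fact l * fps_nth G l)"
proof -
  obtain p where n: "n = Suc p" using assms by (cases n) auto
  have "of_nat (Suc l * (n choose Suc l)) = (of_nat (n * (p choose l)) :: 'a)"
    using Suc_times_binomial_eq[of p l] unfolding n by (simp only: mult_ac)
  then have "of_nat (Suc l) * of_nat (n choose Suc l) = (of_nat n * of_nat (p choose l) :: 'a)"
    by (simp only: of_nat_mult)
  then have "of_nat (n choose Suc l) * (of_nat (Suc l) * (fact l * fps_nth G l)) =
      of_nat n * of_nat (p choose l) * (fact l * fps_nth G l)"
    by (metis mult.assoc mult.commute)
  with assms show ?thesis
    by (simp add: n field_simps del: of_nat_Suc)
qed

text \<open>Logarithmic derivatives add up over a product; \<open>q b\<close> plays the role of t
  f'/f, written without division.\<close>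

lemma fps_X_mult_deriv_prod_list:
  fixes f :: "'b \<Rightarrow> 'a :: comm_ring_1 fps"
  assumes "\<And>b. b \<in> set bs \<Longrightarrow> fps_X * fps_deriv (f b) = f b * q b"
  shows "fps_X * fps_deriv (\<Prod>b\<leftarrow>bs. f b) = (\<Prod>b\<leftarrow>bs. f b) * (\<Sum>b\<leftarrow>bs. q b)"
  using assms
proof (induction bs)
  case (Cons b bs)
  have "fps_X * fps_deriv (\<Prod>b\<leftarrow>b # bs. f b) =
      f b * (fps_X * fps_deriv (\<Prod>b\<leftarrow>bs. f b)) + (fps_X * fps_deriv (f b)) * (\<Prod>b\<leftarrow>bs. f b)"
    by (simp add: algebra_simps)
  also have "\<dots> = f b * ((\<Prod>b\<leftarrow>bs. f b) * (\<Sum>b\<leftarrow>bs. q b)) + (f b * q b) * (\<Prod>b\<leftarrow>bs. f b)"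
    using Cons by simp
  finally show ?case by (simp add: algebra_simps)
qed simp

section \<open>Logarithmic derivatives of the Daehee factors\<close>

definition daehee_factor :: "complex \<Rightarrow> complex fps" where
  "daehee_factor b = fps_ln 1 / (fps_binomial b - 1)"

definition daehee_factor2 :: "complex \<Rightarrow> complex fps" where
  "daehee_factor2 b = fps_binomial b * fps_ln 1 / (fps_binomial b - 1)"

definition cauchy_fps :: "complex fps" where
  "cauchy_fps = fps_X / fps_ln 1"

lemma cauchy_fps_mult_ln: "cauchy_fps * fps_ln 1 = fps_X"
  using cauchy_egf by (simp add: cauchy_num_def cauchy_fps_def fps_nth_inverse)

lemma fps_binomial_minus_1_neq_0: "b \<noteq> 0 \<Longrightarrow> fps_binomial b - 1 \<noteq> (0 :: complex fps)"
  using subdegree_binomial_minus_1 by force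

lemma daehee_factor2_eq: "b \<noteq> 0 \<Longrightarrow> daehee_factor2 b = fps_binomial b * daehee_factor b"
proof -
  assume b: "b \<noteq> 0"
  have "daehee_factor2 b * (fps_binomial b - 1) = fps_binomial b * daehee_factor b * (fps_binomial b - 1)"
    using daehee_quotient[OF b] by (simp add: daehee_factor_def daehee_factor2_def mult.assoc)
  with fps_binomial_minus_1_neq_0[OF b] show ?thesis by simp
qed

text \<open>Differentiate f ((1+t)^b - 1) = ln(1+t), replace t by
  \<open>cauchy_fps * fps_ln 1\<close>, and cancel the nonzero series (1+t)^b - 1. Writing
  1/((1+t)^b - 1) as f/ln(1+t) brings in a second copy of f, the source of the repeated
  parameter.\<close>

lemma fps_X_mult_deriv_daehee_factor:
  assumes "b \<noteq> 0"
  shows "fps_X * fps_deriv (daehee_factor b) = daehee_factor b *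
    (cauchy_fps * fps_binomial (-1) -
     fps_const b * (cauchy_fps * (daehee_factor b * fps_binomial (b - 1))))"
    (is "?l = ?r")
proof -
  let ?B = "fps_binomial b :: complex fps" and ?I = "fps_binomial (-1) :: complex fps"
  let ?f = "daehee_factor b"
  have f: "?f * (?B - 1) = fps_ln 1"
    using daehee_quotient(1)[OF assms] by (simp add: daehee_factor_def)
  have "fps_deriv (?f * (?B - 1)) = ?I"
    by (simp only: f fps_deriv_ln_one)
  then have f': "fps_deriv ?f * (?B - 1) = ?I - ?f * (fps_const b * ?B * ?I)"
    by (simp add: fps_deriv_binomial algebra_simps)
  have "?r * (?B - 1) = (?f * (?B - 1)) * (cauchy_fps * ?I - fps_const b * (cauchy_fps * (?f * (?B * ?I))))"
    by (simp only: fps_binomial_diff_1 mult_ac)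
  also have "\<dots> = (cauchy_fps * fps_ln 1) * (?I - ?f * (fps_const b * ?B * ?I))"
    unfolding f by (simp add: algebra_simps)
  also have "\<dots> = ?l * (?B - 1)"
    unfolding cauchy_fps_mult_ln f'[symmetric] by (simp only: mult.assoc)
  finally show ?thesis
    using fps_binomial_minus_1_neq_0[OF assms] by simp
qed

text \<open>The extra factor (1+t)^b contributes b t/(1+t), the last term. It also turns f
  (1+t)^(b-1) into \<open>daehee_factor2 b * fps_binomial (-1)\<close>, so the argument becomes -1
  instead of b-1.\<close>

lemma fps_X_mult_deriv_daehee_factor2:
  assumes "b \<noteq> 0"
  shows "fps_X * fps_deriv (daehee_factor2 b) = daehee_factor2 b *
    (cauchy_fps * fps_binomial (-1) -
     fps_const b * (cauchy_fps * (daehee_factor2 b * fps_binomial (-1))) +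
     fps_X * (fps_const b * fps_binomial (-1)))"
proof -
  have "fps_X * fps_deriv (daehee_factor2 b) =
      fps_binomial b * (fps_X * fps_deriv (daehee_factor b)) +
      fps_X * daehee_factor b * (fps_const b * fps_binomial b * fps_binomial (-1))"
    by (simp add: daehee_factor2_eq[OF assms] fps_deriv_binomial algebra_simps)
  then show ?thesis
    unfolding fps_X_mult_deriv_daehee_factor[OF assms]
    by (simp add: daehee_factor2_eq[OF assms] fps_binomial_diff_1 algebra_simps)
qed

section \<open>Coefficients of the logarithmic derivative of the product\<close>

lemma sum_list_map_eq_sum_nth: "(\<Sum>b\<leftarrow>bs. g b) = (\<Sum>j<length bs. g (bs ! j))"
  by (simp add: sum_list_sum_nth atLeast0LessThan)

text \<open>The function \<open>h\<close> is left open to cover both kinds of factor; the sum passes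
  to indices to match the sum over j in the claim.\<close>

lemma fps_mult_sum_list_log_deriv:
  fixes F C I :: "'a :: comm_ring_1 fps"
  shows "F * (\<Sum>b\<leftarrow>bs. C * I - fps_const b * (C * (h b))) =
    of_nat (length bs) * (C * (F * I)) - (\<Sum>j<length bs. fps_const (bs ! j) * (C * (F * h (bs ! j))))"
  by (induction bs) (simp_all add: sum.lessThan_Suc_shift algebra_simps del: sum.lessThan_Suc)

lemma fact_mult_cauchy_fps_mult_nth:
  "fact n * fps_nth (cauchy_fps * A) n =
    (\<Sum>i=0..n. of_nat (n choose i) * cauchy_num i * (fact (n - i) * fps_nth A (n - i)))"
  by (simp add: fact_mult_fps_mult_nth cauchy_num_def cauchy_fps_def)

lemma fact_mult_log_deriv_nth:
  fixes h :: "complex \<Rightarrow> complex fps"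
  shows "fact n * fps_nth (of_nat r * (cauchy_fps * A) - (\<Sum>j<r. fps_const (a ! j) * (cauchy_fps * h (a ! j)))) n =
    of_nat r * (\<Sum>i=0..n. of_nat (n choose i) * cauchy_num i * (fact (n - i) * fps_nth A (n - i))) -
    (\<Sum>j<r. \<Sum>i=0..n. of_nat (n choose i) * (a ! j) * cauchy_num i * (fact (n - i) * fps_nth (h (a ! j)) (n - i)))"
proof -
  have nat: "fps_nth (of_nat r * B) n = of_nat r * fps_nth B n" for B :: "complex fps"
    by (simp add: fps_of_nat[symmetric] del: fps_of_nat)
  have "fact n * fps_nth (of_nat r * (cauchy_fps * A) - (\<Sum>j<r. fps_const (a ! j) * (cauchy_fps * h (a ! j)))) n =
    of_nat r * (fact n * fps_nth (cauchy_fps * A) n) -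
    (\<Sum>j<r. (a ! j) * (fact n * fps_nth (cauchy_fps * h (a ! j)) n))"
    by (simp add: nat fps_sum_nth right_diff_distrib sum_distrib_left mult.left_commute[of "fact n"])
  then show ?thesis
    unfolding fact_mult_cauchy_fps_mult_nth by (simp add: sum_distrib_left mult_ac)
qed

theorem theorem7:
  fixes a :: "complex list" and r n m :: nat
  assumes "length a = r" and "r \<ge> 1" and "\<forall>j<r. a ! j \<noteq> 0"
    and "m \<ge> 1" and "n - 1 \<ge> m"
  shows
    "(\<Sum>l=0..n-m. of_nat (n choose l) * of_int (S1 (n-l) m) * daehee_num l a) =
       (\<Sum>l=0..n-m. of_nat ((n-1) choose l) * of_int (S1 (n-l-1) (m-1)) * daehee_poly l (-1) a)
       + 1 / of_nat n *
         (\<Sum>l=0..n-m-1. of_nat (n choose (l+1)) * of_int (S1 (n-l-1) m) *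
           (of_nat r * (\<Sum>i=0..l+1. of_nat ((l+1) choose i) * cauchy_num i * daehee_poly (l+1-i) (-1) a)
            - (\<Sum>j<r. \<Sum>i=0..l+1. of_nat ((l+1) choose i) * (a ! j) * cauchy_num i
                 * daehee_poly (l+1-i) (a ! j - 1) (a @ [a ! j]))))
     \<and>
     (\<Sum>l=0..n-m. of_nat (n choose l) * of_int (S1 (n-l) m) * daehee_num2 l a) =
       (\<Sum>l=0..n-m. of_nat ((n-1) choose l) * of_int (S1 (n-l-1) (m-1)) * daehee_poly2 l (-1) a)
       + 1 / of_nat n *
         (\<Sum>l=0..n-m-1. of_nat (n choose (l+1)) * of_int (S1 (n-l-1) m) *
           (of_nat r * (\<Sum>i=0..l+1. of_nat ((l+1) choose i) * cauchy_num i * daehee_poly2 (l+1-i) (-1) a)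
            - (\<Sum>j<r. \<Sum>i=0..l+1. of_nat ((l+1) choose i) * (a ! j) * cauchy_num i
                 * daehee_poly2 (l+1-i) (-1) (a @ [a ! j]))))
       + (\<Sum>l=0..n-m-1. of_nat ((n-1) choose l) * of_int (S1 (n-l-1) m) *
           (\<Sum>j<r. (a ! j) * daehee_poly2 l (-1) a))"
proof -
  let ?I = "fps_binomial (-1) :: complex fps"
  let ?F = "\<Prod>b\<leftarrow>a. daehee_factor b" and ?F2 = "\<Prod>b\<leftarrow>a. daehee_factor2 b"
  have nz: "b \<noteq> 0" if "b \<in> set a" for b
    using that assms(1,3) by (auto simp: in_set_conv_nth)
  have n: "n > 0" using assms by auto

  have poly: "daehee_poly l x bs = fact l * fps_nth ((\<Prod>b\<leftarrow>bs. daehee_factor b) * fps_binomial x) l" for l x bs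
    by (simp add: daehee_poly_def daehee_factor_def)
  have poly2: "daehee_poly2 l x bs = fact l * fps_nth ((\<Prod>b\<leftarrow>bs. daehee_factor2 b) * fps_binomial x) l" for l x bs
    by (simp add: daehee_poly2_def daehee_factor2_def)
  have num: "daehee_num l a = fact l * fps_nth ?F l" "daehee_num2 l a = fact l * fps_nth ?F2 l" for l
    by (simp_all add: daehee_num_def daehee_num2_def poly poly2)

  have F': "fps_X * fps_deriv ?F = of_nat r * (cauchy_fps * (?F * ?I)) -
      (\<Sum>j<r. fps_const (a ! j) * (cauchy_fps * (?F * (daehee_factor (a ! j) * fps_binomial (a ! j - 1)))))"
    using fps_X_mult_deriv_prod_list[of a daehee_factor, OF fps_X_mult_deriv_daehee_factor[OF nz]]
    unfolding fps_mult_sum_list_log_deriv assms(1) by simp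
  \<comment> \<open>Multiplying \<open>?F\<close> by \<open>daehee_factor (a ! j)\<close> gives the
    product over \<open>a @ [a ! j]\<close>.\<close>
  have bracket: "fact k * fps_nth (fps_X * fps_deriv ?F) k =
      of_nat r * (\<Sum>i=0..k. of_nat (k choose i) * cauchy_num i * daehee_poly (k-i) (-1) a)
      - (\<Sum>j<r. \<Sum>i=0..k. of_nat (k choose i) * (a ! j) * cauchy_num i
           * daehee_poly (k-i) (a ! j - 1) (a @ [a ! j]))" for k
    unfolding F' fact_mult_log_deriv_nth[where h = "\<lambda>b. ?F * (daehee_factor b * fps_binomial (b - 1))"] poly
    by (simp add: mult.assoc)

  \<comment> \<open>\<open>G\<close> is the derivative of \<open>?F2\<close> without the
    contribution of the terms b/(1+t). These need no Cauchy series and form the separate last sum of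
    the second identity.\<close>
  define G where "G = fps_deriv ?F2 - (\<Sum>b\<leftarrow>a. fps_const b) * (?F2 * ?I)"
  have "fps_X * fps_deriv ?F2 = ?F2 * (\<Sum>b\<leftarrow>a. (cauchy_fps * ?I -
      fps_const b * (cauchy_fps * (daehee_factor2 b * ?I))) + fps_X * (fps_const b * ?I))"
    by (rule fps_X_mult_deriv_prod_list) (rule fps_X_mult_deriv_daehee_factor2[OF nz])
  also have "\<dots> = ?F2 * (\<Sum>b\<leftarrow>a. cauchy_fps * ?I - fps_const b * (cauchy_fps * (daehee_factor2 b * ?I)))
      + fps_X * ((\<Sum>b\<leftarrow>a. fps_const b) * (?F2 * ?I))"
    unfolding sum_list_addf sum_list_const_mult sum_list_mult_const by (simp add: algebra_simps)
  finally have G: "fps_X * G = of_nat r * (cauchy_fps * (?F2 * ?I)) -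
      (\<Sum>j<r. fps_const (a ! j) * (cauchy_fps * (?F2 * (daehee_factor2 (a ! j) * ?I))))"
    unfolding fps_mult_sum_list_log_deriv assms(1) G_def by (simp add: right_diff_distrib)
  have bracket2: "fact k * fps_nth (fps_X * G) k =
      of_nat r * (\<Sum>i=0..k. of_nat (k choose i) * cauchy_num i * daehee_poly2 (k-i) (-1) a)
      - (\<Sum>j<r. \<Sum>i=0..k. of_nat (k choose i) * (a ! j) * cauchy_num i
           * daehee_poly2 (k-i) (-1) (a @ [a ! j]))" for k
    unfolding G fact_mult_log_deriv_nth[where h = "\<lambda>b. ?F2 * (daehee_factor2 b * ?I)"] poly2
    by (simp add: mult.assoc)

  have const: "(\<Sum>b\<leftarrow>a. fps_const b) = fps_const (\<Sum>j<r. a ! j)"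
  proof -
    have "(\<Sum>b\<leftarrow>bs. fps_const b) = fps_const (\<Sum>b\<leftarrow>bs. b)" for bs :: "complex list"
      by (induction bs) simp_all
    from this[of a] show ?thesis by (simp only: sum_list_map_eq_sum_nth assms(1))
  qed
  have deriv2: "fact l * fps_nth (fps_deriv ?F2) l =
      fact l * fps_nth G l + (\<Sum>j<r. (a ! j) * daehee_poly2 l (-1) a)" for l
    unfolding sum_distrib_right[symmetric]
    by (simp add: G_def const poly2 right_diff_distrib del: fps_deriv_nth)

  \<comment> \<open>Used with H = F' for the first kind and H = \<open>G\<close> for the second;
    \<open>bracket\<close> and \<open>bracket2\<close> then apply with k = l+1.\<close>
  have weight: "(\<Sum>l\<in>A. of_nat ((n-1) choose l) * s l * (fact l * fps_nth H l)) =
      1 / of_nat n * (\<Sum>l\<in>A. of_nat (n choose (l+1)) * s l * (fact (l+1) * fps_nth (fps_X * H) (l+1)))"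
    for A s and H :: "complex fps"
    unfolding sum_distrib_left
  proof (rule sum.cong[OF refl])
    fix l
    show "of_nat ((n-1) choose l) * s l * (fact l * fps_nth H l) =
        1 / of_nat n * (of_nat (n choose (l+1)) * s l * (fact (l+1) * fps_nth (fps_X * H) (l+1)))"
      using arg_cong[OF choose_mult_fact_mult_X_mult_nth[OF n, of l H], of "\<lambda>z. s l * z"]
      by (simp only: mult_ac)
  qed

  show ?thesis
    using S1_convolution_deriv[OF assms(4,5), of ?F] S1_convolution_deriv[OF assms(4,5), of ?F2]
    unfolding num[symmetric] poly[symmetric] poly2[symmetric] deriv2 distrib_left sum.distrib
      weight bracket bracket2
    by (simp only: add.assoc)
qed

end
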